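(* For every even $n\in\mathbb{N}$ and every $f:M_n(\mathbb{F}_2)\to L_1$, $$\sum_{j=1}^n\sum_{x\in M_n(\mathbb{F}_2)}\Big\|f\Big(x+\sum_{k=1}^n e_{jk}\Big)-f(x)\Big\|_1\le\frac{2n}{n^n-(n-2)^n}\sum_{k\in\{1,\ldots,n\}^n}\ \sum_{x\in M_n(\mathbb{F}_2)}\Big\|f\Big(x+\sum_{j=1}^n e_{jk_j}\Big)-f(x)\Big\|_1 .$$ For every fixed even $n\in\mathbb{N}$ the factor $\frac{2n}{n^n-(n-2)^n}$ cannot be improved, i.e. it cannot be replaced by any strictly smaller number so that the inequality still holds for all $f:M_n(\mathbb{F}_2)\to L_1$. Consequently, $L_1$ is a KS space: for every even $n\in\mathbb{N}$ and every $f:M_n(\mathbb{F}_2)\to L_1$, $$\frac1n\sum_{j=1}^n\sum_{x\in M_n(\mathbb{F}_2)}\Big\|f\Big(x+\sum_{k=1}^n e_{jk}\Big)-f(x)\Big\|_1\le\frac{C}{n^n}\sum_{k\in\{1,\ldots,n\}^n}\ \sum_{x\in M_n(\mathbb{F}_2)}\Big\|f\Big(x+\sum_{j=1}^n e_{jk_j}\Big)-f(x)\Big\|_1$$ with $$C=\sup_{n\in2\mathbb{N}}\frac{2}{1-\left(1-\frac2n\right)^n}=\frac{2e^2}{e^2-1},$$ and this value of $C$ cannot be improved, i.e. no strictly smaller constant $C$ makes the last inequality valid for all even $n\in\mathbb{N}$ and all $f:M_n(\mathbb{F}_2)\to L_1$.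
   Context: $\mathbb{N}=\{1,2,3,\ldots\}$, $2\mathbb{N}$ is the set of even positive integers, and $\mathbb{F}_2$ is the field with two elements. $M_n(\mathbb{F}_2)$ is the $\mathbb{F}_2$-vector space of all $n\times n$ matrices over $\mathbb{F}_2$, and $e_{jk}\in M_n(\mathbb{F}_2)$ is the matrix whose $(j,k)$ entry is $1$ and whose other entries are $0$. For $k\in\{1,\ldots,n\}^n$ write $k=(k_1,\ldots,k_n)$. $L_1=L_1(0,1)$ (real-valued functions, Lebesgue measure) with norm $\|\cdot\|_1$. A metric space $(X,d_X)$ is called a KS space if there exists $C=C(X)\in(0,\infty)$ such that for every even $n\in\mathbb{N}$ and every $f:M_n(\mathbb{F}_2)\to X$, $$\frac1n\sum_{j=1}^n\sum_{x\in M_n(\mathbb{F}_2)}d_X\Big(f\Big(x+\sum_{k=1}^n e_{jk}\Big),f(x)\Big)\le\frac{C}{n^n}\sum_{k\in\{1,\ldots,n\}^n}\ \sum_{x\in M_n(\mathbb{F}_2)}d_X\Big(f\Big(x+\sum_{j=1}^n e_{jk_j}\Big),f(x)\Big).$$ *)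

theory Defs
  imports "HOL-Analysis.Analysis" "HOL-Library.Z2" "Jordan_Normal_Form.Matrix"
begin

section \<open>The Banach space $L_1(0,1)$\<close>

definition L1_eq :: "(real \<Rightarrow> real) \<Rightarrow> (real \<Rightarrow> real) \<Rightarrow> bool" where
  "L1_eq f g \<longleftrightarrow>
     integrable (lebesgue_on {0<..<1}) f \<and> integrable (lebesgue_on {0<..<1}) g \<and>
     (AE t in lebesgue_on {0<..<1}. f t = g t)"

quotient_type L1 = "real \<Rightarrow> real" / partial: L1_eq
proof (rule part_equivpI)
  show "\<exists>f. L1_eq f f"
    by (rule exI[of _ "\<lambda>_. 0"]) (simp add: L1_eq_def)
  show "symp L1_eq"
    by (auto simp: symp_def L1_eq_def elim!: eventually_mono)
  show "transp L1_eq"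
    unfolding transp_def L1_eq_def by (auto elim: eventually_elim2)
qed

instantiation L1 :: real_normed_vector
begin

lift_definition zero_L1 :: L1 is "\<lambda>_. 0"
  by (simp add: L1_eq_def)

lift_definition plus_L1 :: "L1 \<Rightarrow> L1 \<Rightarrow> L1" is "\<lambda>f g t. f t + g t"
  unfolding L1_eq_def by (auto elim: eventually_elim2)

lift_definition minus_L1 :: "L1 \<Rightarrow> L1 \<Rightarrow> L1" is "\<lambda>f g t. f t - g t"
  unfolding L1_eq_def by (auto elim: eventually_elim2)

lift_definition uminus_L1 :: "L1 \<Rightarrow> L1" is "\<lambda>f t. - f t"
  unfolding L1_eq_def by (auto elim!: eventually_mono)

lift_definition scaleR_L1 :: "real \<Rightarrow> L1 \<Rightarrow> L1" is "\<lambda>c f t. c * f t"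
  unfolding L1_eq_def by (auto elim!: eventually_mono)

lift_definition norm_L1 :: "L1 \<Rightarrow> real" is "\<lambda>f. \<integral>t. \<bar>f t\<bar> \<partial>lebesgue_on {0<..<1}"
  unfolding L1_eq_def by (intro integral_cong_AE) (auto elim!: eventually_mono)

definition dist_L1 :: "L1 \<Rightarrow> L1 \<Rightarrow> real" where
  "dist_L1 u v = norm (u - v)"

definition sgn_L1 :: "L1 \<Rightarrow> L1" where
  "sgn_L1 u = scaleR (inverse (norm u)) u"

definition uniformity_L1 :: "(L1 \<times> L1) filter" where
  "uniformity_L1 = (INF e\<in>{0<..}. principal {(u, v). dist u v < e})"

definition open_L1 :: "L1 set \<Rightarrow> bool" where
  "open_L1 U \<longleftrightarrow> (\<forall>u\<in>U. \<forall>\<^sub>F (u', v) in uniformity. u' = u \<longrightarrow> v \<in> U)"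

instance
proof
  fix u v w :: L1 and a b :: real
  show "u + v + w = u + (v + w)"
    by transfer (auto simp: L1_eq_def add.assoc)
  show "u + v = v + u"
    by transfer (auto simp: L1_eq_def add.commute)
  show "0 + u = u"
    by transfer (auto simp: L1_eq_def)
  show "- u + u = 0"
    by transfer (auto simp: L1_eq_def)
  show "u - v = u + - v"
    by transfer (auto simp: L1_eq_def)
  show "a *\<^sub>R (u + v) = a *\<^sub>R u + a *\<^sub>R v"
    by transfer (auto simp: L1_eq_def distrib_left)
  show "(a + b) *\<^sub>R u = a *\<^sub>R u + b *\<^sub>R u"
    by transfer (auto simp: L1_eq_def distrib_right)
  show "a *\<^sub>R b *\<^sub>R u = (a * b) *\<^sub>R u"
    by transfer (auto simp: L1_eq_def mult.assoc)
  show "1 *\<^sub>R u = u"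
    by transfer (auto simp: L1_eq_def)
  show "dist u v = norm (u - v)"
    by (simp add: dist_L1_def)
  show "sgn u = scaleR (inverse (norm u)) u"
    by (simp add: sgn_L1_def)
  show "uniformity = (INF e\<in>{0<..}. principal {(u, v :: L1). dist u v < e})"
    by (simp add: uniformity_L1_def)
  show "open U \<longleftrightarrow> (\<forall>u\<in>U. \<forall>\<^sub>F (u', v) in uniformity. u' = u \<longrightarrow> v \<in> U)"
    for U :: "L1 set"
    by (simp add: open_L1_def)
  show "norm u = 0 \<longleftrightarrow> u = 0"
    by transfer (auto simp: L1_eq_def integral_nonneg_eq_0_iff_AE)
  show "norm (u + v) \<le> norm u + norm v"
  proof transfer
    fix f g assume "L1_eq f f" "L1_eq g g"
    then have int: "integrable (lebesgue_on {0<..<1}) f" "integrable (lebesgue_on {0<..<1}) g"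
      by (auto simp: L1_eq_def)
    have "(\<integral>t. \<bar>f t + g t\<bar> \<partial>lebesgue_on {0<..<1})
        \<le> (\<integral>t. \<bar>f t\<bar> + \<bar>g t\<bar> \<partial>lebesgue_on {0<..<1})"
      using int by (intro integral_mono) auto
    also have "\<dots> = (\<integral>t. \<bar>f t\<bar> \<partial>lebesgue_on {0<..<1}) + (\<integral>t. \<bar>g t\<bar> \<partial>lebesgue_on {0<..<1})"
      using int by (intro Bochner_Integration.integral_add) auto
    finally show "(\<integral>t. \<bar>f t + g t\<bar> \<partial>lebesgue_on {0<..<1})
      \<le> (\<integral>t. \<bar>f t\<bar> \<partial>lebesgue_on {0<..<1}) + (\<integral>t. \<bar>g t\<bar> \<partial>lebesgue_on {0<..<1})" .
  qed
  show "norm (a *\<^sub>R u) = \<bar>a\<bar> * norm u"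
    by transfer (auto simp: abs_mult)
qed

end


section \<open>KS spaces\<close>

text \<open>
  The field with two elements is the type \<^typ>\<open>bit\<close>, and $M_n(\mathbb{F}_2)$ is the finite set
  \<^term>\<open>carrier_mat n n :: bit mat set\<close>.  Rows and columns are numbered from 0, so
  $\{1,\ldots,n\}$ becomes \<^term>\<open>{..<n}\<close> and $\{1,\ldots,n\}^n$ becomes
  \<^term>\<open>{..<n} \<rightarrow>\<^sub>E {..<n}\<close>.  Functions on $M_n(\mathbb{F}_2)$ are total functions on
  \<^typ>\<open>bit mat\<close> whose values outside \<^term>\<open>carrier_mat n n\<close> are never used.
\<close>

lemma finite_carrier_mat_bit: "finite (carrier_mat n m :: bit mat set)"
proof -
  have "x \<in> (\<lambda>g. mat n m g) ` (({..<n} \<times> {..<m}) \<rightarrow>\<^sub>E UNIV)"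
    if "x \<in> carrier_mat n m" for x :: "bit mat"
  proof (rule image_eqI)
    show "x = mat n m (restrict (\<lambda>p. x $$ p) ({..<n} \<times> {..<m}))"
      using that by (intro eq_matI) auto
  qed auto
  then have "carrier_mat n m
      \<subseteq> (\<lambda>g. mat n m g) ` (({..<n} \<times> {..<m}) \<rightarrow>\<^sub>E (UNIV :: bit set))"
    by blast
  moreover have "(UNIV :: bit set) = {0, 1}"
    by (metis (full_types) UNIV_eq_I bit_not_zero_iff insertI1 insertI2)
  then have "finite (UNIV :: bit set)"
    by (metis finite.emptyI finite.insertI)
  ultimately show ?thesis
    by (meson finite_PiE finite_SigmaI finite_imageI finite_lessThan finite_subset)
qed

definition mat_unit :: "nat \<Rightarrow> nat \<Rightarrow> nat \<Rightarrow> bit mat" where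
  "mat_unit n j k = mat n n (\<lambda>(a, b). if a = j \<and> b = k then 1 else 0)"

text \<open>
  Matrices of all dimensions share one type, which is therefore not a monoid under addition; finite
  sums in $M_n(\mathbb{F}_2)$ are taken in the structure \<^term>\<open>module_mat TYPE(bit) n n\<close>.
\<close>

abbreviation sum_bit_mat :: "nat \<Rightarrow> (nat \<Rightarrow> bit mat) \<Rightarrow> bit mat" where
  "sum_bit_mat n g \<equiv> finsum (module_mat TYPE(bit) n n) g {..<n}"

text \<open>
  \<open>row_variation n f\<close> is
  $\sum_{j=1}^n\sum_{x} d(f(x+\sum_{k=1}^n e_{jk}),f(x))$, and
  \<open>transversal_variation n f\<close> is
  $\sum_{k\in\{1,\ldots,n\}^n}\sum_{x} d(f(x+\sum_{j=1}^n e_{jk_j}),f(x))$.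
  On \<^typ>\<open>L1\<close> the distance is the norm of the difference.
\<close>

definition row_variation :: "nat \<Rightarrow> (bit mat \<Rightarrow> 'a::metric_space) \<Rightarrow> real" where
  "row_variation n f =
     (\<Sum>j<n. \<Sum>x\<in>carrier_mat n n.
        dist (f (x + sum_bit_mat n (\<lambda>k. mat_unit n j k))) (f x))"

definition transversal_variation :: "nat \<Rightarrow> (bit mat \<Rightarrow> 'a::metric_space) \<Rightarrow> real" where
  "transversal_variation n f =
     (\<Sum>k\<in>{..<n} \<rightarrow>\<^sub>E {..<n}. \<Sum>x\<in>carrier_mat n n.
        dist (f (x + sum_bit_mat n (\<lambda>j. mat_unit n j (k j)))) (f x))"

definition KS_inequality :: "real \<Rightarrow> nat \<Rightarrow> (bit mat \<Rightarrow> 'a::metric_space) \<Rightarrow> bool" where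
  "KS_inequality C n f \<longleftrightarrow>
     1 / real n * row_variation n f \<le> C / real n ^ n * transversal_variation n f"

definition even_pos :: "nat set" where
  "even_pos = {n. even n \<and> n > 0}"

definition KS_space :: "'a::metric_space itself \<Rightarrow> bool" where
  "KS_space _ \<longleftrightarrow>
     (\<exists>C>0. \<forall>n\<in>even_pos. \<forall>f :: bit mat \<Rightarrow> 'a. KS_inequality C n f)"

end

theory Submission
  imports Defs
begin

text \<open>
  Both sides of the inequality are sums of distances $d(f(x), f(y))$, and the $L_1$ metric is an
  integral of cut metrics: writing the $L_1$ norm as an integral over $t$ and then
  $|a - b| = \int |1_{s<a} - 1_{s<b}| \, ds$ reduces the inequality to functions with values in
  $\{0,1\}$ (\<open>variation_inequality_integral\<close>).  For such functions a distance equals its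
  own square, so the inequality becomes a comparison of two translation invariant quadratic forms
  on $\mathbb{F}_2^{n \times n}$.  These are simultaneously diagonalised by the characters
  $W_A(x) = \prod_{p \in A} (-1)^{x_p}$ (\<open>sum_increment_squared\<close>), and it suffices to compare
  eigenvalues.

  Let $a_j$ be the number of elements of $A$ in row $j$, and let $m$ be the number of rows with $a_j$ odd.
  Adding the all-ones row $j$ multiplies $W_A$ by $(-1)^{a_j}$, which gives the eigenvalue $4m$ on the left.
  Averaging $W_A$ over the transversals gives $\prod_j (1 - 2a_j/n)$.  As $n$ is even,
  an odd $a_j$ is neither $0$ nor $n$, so each odd row contributes a factor of modulus at most
  $1 - 2/n$; the eigenvalue on the right is thus at least $2 n^n (1 - q^m)$ with $q = 1 - 2/n$.
  What remains is $m (1 - q^n) \le n (1 - q^m)$ for $m \le n$, which is the concavity of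
  $m \mapsto 1 - q^m$ (\<open>geometric_concave\<close>, \<open>spectral_inequality\<close>).

  All these estimates are equalities when $A$ has exactly one element in each row.  The character of the first
  column, times a nonzero vector, is therefore extremal for every $n$.  The dimension-free
  constant follows because $(1 - 2/n)^n$ is at most $e^{-2}$ and converges to it.
\<close>

section \<open>Walsh characters of $M_n(\mathbb{F}_2)$\<close>

definition bit_sign :: "bit \<Rightarrow> real" where
  "bit_sign b = (if b = 0 then 1 else - 1)"

lemma bit_sign_add: "bit_sign (a + b) = bit_sign a * bit_sign b"
  by (cases "a = 0"; cases "b = 0") (auto simp: bit_sign_def)

text \<open>
  The character of $M_n(\mathbb{F}_2)$ indexed by a set $A$ of positions, with values $\pm 1$.
\<close>

definition walsh :: "(nat \<times> nat) set \<Rightarrow> bit mat \<Rightarrow> real" where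
  "walsh A x = (\<Prod>p\<in>A. bit_sign (x $$ p))"

lemma walsh_add:
  assumes "A \<subseteq> {..<n} \<times> {..<n}" "x \<in> carrier_mat n n" "y \<in> carrier_mat n n"
  shows "walsh A (x + y) = walsh A x * walsh A y"
  unfolding walsh_def prod.distrib[symmetric]
  using assms by (intro prod.cong) (auto simp: bit_sign_add[symmetric] simp del: add_bit_eq_xor)

lemma abs_walsh [simp]: "\<bar>walsh A x\<bar> = 1"
  unfolding walsh_def abs_prod by (intro prod.neutral) (simp add: bit_sign_def)

lemma walsh_squared [simp]: "(walsh A x)\<^sup>2 = 1"
  by (metis abs_walsh one_power2 power2_abs)

lemma walsh_pm_one: "walsh A x = 1 \<or> walsh A x = - 1"
  using walsh_squared[of A x] by (simp only: power2_eq_1_iff)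

lemma bit_mat_add_cancel:
  fixes x a :: "bit mat"
  assumes "x \<in> carrier_mat n n" "a \<in> carrier_mat n n"
  shows "x + a + a = x"
proof (rule eq_matI)
  fix i j assume "i < dim_row x" "j < dim_col x"
  moreover have "b + c + c = b" for b c :: bit
    by (cases "b = 0"; cases "c = 0") auto
  ultimately show "(x + a + a) $$ (i, j) = x $$ (i, j)"
    using assms by (simp del: add_bit_eq_xor)
qed (use assms in auto)

lemma sum_translate_bit_mat:
  fixes g :: "bit mat \<Rightarrow> real"
  assumes "a \<in> carrier_mat n n"
  shows "(\<Sum>x\<in>carrier_mat n n. g (x + a)) = (\<Sum>x\<in>carrier_mat n n. g x)"
  by (rule sum.reindex_bij_witness[where i = "\<lambda>x. x + a" and j = "\<lambda>x. x + a"])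
    (use assms in \<open>auto simp: bit_mat_add_cancel\<close>)

text \<open>
  Summing over all $A$ expands the product $\prod_p (1 + (-1)^{x_p + y_p})$, which has a vanishing factor
  as soon as $x$ and $y$ differ somewhere.
\<close>

lemma walsh_orthogonality:
  assumes "x \<in> carrier_mat n n" "y \<in> carrier_mat n n"
  shows "(\<Sum>A\<in>Pow ({..<n} \<times> {..<n}). walsh A x * walsh A y) = (if x = y then 2 ^ (n * n) else 0)"
proof -
  let ?I = "{..<n} \<times> {..<n}"
  have "(\<Sum>A\<in>Pow ?I. walsh A x * walsh A y)
      = (\<Sum>A\<in>Pow ?I. (\<Prod>p\<in>A. bit_sign (x $$ p) * bit_sign (y $$ p)) * (\<Prod>p\<in>?I - A. 1))"
    by (simp add: walsh_def prod.distrib)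
  also have "\<dots> = (\<Prod>p\<in>?I. bit_sign (x $$ p) * bit_sign (y $$ p) + 1)"
    by (rule prod_add[symmetric]) simp
  also have "\<dots> = (if x = y then 2 ^ (n * n) else 0)"
  proof (cases "x = y")
    case True
    have "bit_sign b * bit_sign b = 1" for b
      by (simp add: bit_sign_def)
    with True show ?thesis
      by (simp add: card_cartesian_product)
  next
    case False
    then obtain i j where ij: "i < n" "j < n" "x $$ (i, j) \<noteq> y $$ (i, j)"
      using assms by (metis carrier_matD eq_matI)
    then have "bit_sign (x $$ (i, j)) * bit_sign (y $$ (i, j)) + 1 = 0"
      by (auto simp: bit_sign_def)
    then have "(\<Prod>p\<in>?I. bit_sign (x $$ p) * bit_sign (y $$ p) + 1) = 0"
      using ij by (intro prod_zero bexI[of _ "(i, j)"]) auto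
    with False show ?thesis
      by simp
  qed
  finally show ?thesis .
qed

text \<open>
  The Fourier coefficients are left unnormalised, whence the factor $2^{n^2}$ in Parseval's identity.
\<close>

definition walsh_coeff :: "nat \<Rightarrow> (bit mat \<Rightarrow> real) \<Rightarrow> (nat \<times> nat) set \<Rightarrow> real" where
  "walsh_coeff n g A = (\<Sum>x\<in>carrier_mat n n. g x * walsh A x)"

lemma walsh_parseval:
  "(\<Sum>A\<in>Pow ({..<n} \<times> {..<n}). (walsh_coeff n g A)\<^sup>2) = 2 ^ (n * n) * (\<Sum>x\<in>carrier_mat n n. (g x)\<^sup>2)"
proof -
  let ?M = "carrier_mat n n :: bit mat set" and ?P = "Pow ({..<n} \<times> {..<n})"
  have "(\<Sum>A\<in>?P. (walsh_coeff n g A)\<^sup>2)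
      = (\<Sum>A\<in>?P. \<Sum>x\<in>?M. \<Sum>y\<in>?M. g x * g y * (walsh A x * walsh A y))"
    by (simp add: walsh_coeff_def power2_eq_square sum_product mult_ac)
  also have "\<dots> = (\<Sum>x\<in>?M. \<Sum>A\<in>?P. \<Sum>y\<in>?M. g x * g y * (walsh A x * walsh A y))"
    by (rule sum.swap)
  also have "\<dots> = (\<Sum>x\<in>?M. \<Sum>y\<in>?M. \<Sum>A\<in>?P. g x * g y * (walsh A x * walsh A y))"
    by (intro sum.cong refl sum.swap)
  also have "\<dots> = (\<Sum>x\<in>?M. \<Sum>y\<in>?M. if x = y then 2 ^ (n * n) * (g x)\<^sup>2 else 0)"
    by (intro sum.cong refl)
      (auto simp: sum_distrib_left[symmetric] walsh_orthogonality power2_eq_square)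
  also have "\<dots> = 2 ^ (n * n) * (\<Sum>x\<in>?M. (g x)\<^sup>2)"
    by (simp add: finite_carrier_mat_bit sum_distrib_left)
  finally show ?thesis .
qed

text \<open>
  Translations act diagonally on the characters; this is why the squared increments below are
  weighted sums of squared coefficients.
\<close>

lemma walsh_coeff_increment:
  assumes "A \<subseteq> {..<n} \<times> {..<n}" "a \<in> carrier_mat n n"
  shows "walsh_coeff n (\<lambda>x. g (x + a) - g x) A = (walsh A a - 1) * walsh_coeff n g A"
proof -
  have "(\<Sum>x\<in>carrier_mat n n. g (x + a) * walsh A x)
      = (\<Sum>x\<in>carrier_mat n n. g (x + a) * (walsh A (x + a) * walsh A a))"
    using assms by (intro sum.cong)
      (auto simp: walsh_add[OF assms(1)] mult.assoc power2_eq_square[symmetric])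
  also have "\<dots> = (\<Sum>x\<in>carrier_mat n n. g x * (walsh A x * walsh A a))"
    by (rule sum_translate_bit_mat[OF assms(2)])
  finally show ?thesis
    by (simp add: walsh_coeff_def algebra_simps sum_subtractf sum_distrib_left)
qed

lemma sum_increment_squared:
  assumes "a \<in> carrier_mat n n"
  shows "2 ^ (n * n) * (\<Sum>x\<in>carrier_mat n n. (g (x + a) - g x)\<^sup>2)
       = (\<Sum>A\<in>Pow ({..<n} \<times> {..<n}). (walsh A a - 1)\<^sup>2 * (walsh_coeff n g A)\<^sup>2)"
  unfolding walsh_parseval[symmetric]
  using assms by (intro sum.cong) (auto simp: walsh_coeff_increment power_mult_distrib)


section \<open>Values of the characters on rows and transversals\<close>

lemma mat_unit_carrier [simp]: "mat_unit n j k \<in> carrier_mat n n"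
  by (simp add: mat_unit_def)

lemma walsh_mat_unit:
  assumes "A \<subseteq> {..<n} \<times> {..<n}" "j < n" "k < n"
  shows "walsh A (mat_unit n j k) = (if (j, k) \<in> A then - 1 else 1)"
proof -
  have "finite A"
    using assms(1) by (rule finite_subset) simp
  have "walsh A (mat_unit n j k) = (\<Prod>p\<in>A. if p = (j, k) then - 1 else 1)"
    unfolding walsh_def
  proof (intro prod.cong refl)
    fix p assume "p \<in> A"
    then obtain a b where "p = (a, b)" "a < n" "b < n"
      using assms(1) by auto
    then show "bit_sign (mat_unit n j k $$ p) = (if p = (j, k) then - 1 else 1)"
      by (simp add: mat_unit_def bit_sign_def)
  qed
  with \<open>finite A\<close> show ?thesis
    by simp
qed

lemma
  assumes g: "\<And>i. i \<in> F \<Longrightarrow> g i \<in> carrier_mat n n" and "finite F"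
  shows finsum_bit_mat_carrier: "finsum (module_mat TYPE(bit) n n) g F \<in> carrier_mat n n"
    and walsh_finsum: "A \<subseteq> {..<n} \<times> {..<n} \<Longrightarrow>
      walsh A (finsum (module_mat TYPE(bit) n n) g F) = (\<Prod>i\<in>F. walsh A (g i))"
proof -
  interpret abelian_group "module_mat TYPE(bit) n n"
    by (rule abelian_group_mat)
  have closed: "finsum (module_mat TYPE(bit) n n) g G \<in> carrier_mat n n" if "G \<subseteq> F" for G
    using finsum_closed[of g G] g that by (auto simp: module_mat_simps)
  from closed show "finsum (module_mat TYPE(bit) n n) g F \<in> carrier_mat n n"
    by blast
  assume A: "A \<subseteq> {..<n} \<times> {..<n}"
  have "G \<subseteq> F \<Longrightarrow> walsh A (finsum (module_mat TYPE(bit) n n) g G) = (\<Prod>i\<in>G. walsh A (g i))"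
    if "finite G" for G
    using that
  proof (induction G rule: finite_induct)
    case empty
    have "walsh A (0\<^sub>m n n) = 1"
      unfolding walsh_def using A by (intro prod.neutral) (auto simp: bit_sign_def)
    then show ?case
      by (simp add: module_mat_simps)
  next
    case (insert i G)
    then have "g \<in> G \<rightarrow> carrier_mat n n" "g i \<in> carrier_mat n n"
      using g by auto
    with insert.hyps have "finsum (module_mat TYPE(bit) n n) g (insert i G)
        = g i + finsum (module_mat TYPE(bit) n n) g G"
      using finsum_insert[of G i g] by (simp add: module_mat_simps)
    with insert g closed show ?case
      by (simp add: walsh_add[OF A])
  qed
  with \<open>finite F\<close> show "walsh A (finsum (module_mat TYPE(bit) n n) g F) = (\<Prod>i\<in>F. walsh A (g i))"
    by blast
qed

definition row_mat :: "nat \<Rightarrow> nat \<Rightarrow> bit mat" where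
  "row_mat n j = sum_bit_mat n (\<lambda>k. mat_unit n j k)"

definition transversal_mat :: "nat \<Rightarrow> (nat \<Rightarrow> nat) \<Rightarrow> bit mat" where
  "transversal_mat n k = sum_bit_mat n (\<lambda>j. mat_unit n j (k j))"

lemma row_mat_carrier [simp]: "row_mat n j \<in> carrier_mat n n"
  and transversal_mat_carrier [simp]: "transversal_mat n k \<in> carrier_mat n n"
  by (simp_all add: row_mat_def transversal_mat_def finsum_bit_mat_carrier)

definition row_count :: "nat \<Rightarrow> (nat \<times> nat) set \<Rightarrow> nat \<Rightarrow> nat" where
  "row_count n A j = card {k\<in>{..<n}. (j, k) \<in> A}"

lemma prod_sign_row: "(\<Prod>k<n. if (j, k) \<in> A then - 1 else 1 :: real) = (- 1) ^ row_count n A j"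
  by (simp add: prod.If_cases row_count_def Int_def)

lemma sum_sign_row: "(\<Sum>k<n. if (j, k) \<in> A then - 1 else 1 :: real) = real n - 2 * real (row_count n A j)"
proof -
  have "(\<Sum>k<n. if (j, k) \<in> A then - 1 else 1 :: real) = (\<Sum>k<n. 1 - 2 * (if (j, k) \<in> A then 1 else 0))"
    by (intro sum.cong) auto
  also have "\<dots> = real n - 2 * real (row_count n A j)"
    by (simp add: sum_subtractf sum_distrib_left[symmetric] row_count_def sum.If_cases Int_def)
  finally show ?thesis .
qed

lemma walsh_row_mat:
  assumes "A \<subseteq> {..<n} \<times> {..<n}" "j < n"
  shows "walsh A (row_mat n j) = (- 1) ^ row_count n A j"
  using assms by (simp add: row_mat_def walsh_finsum walsh_mat_unit prod_sign_row)

text \<open>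
  A transversal chooses one entry in each row independently, so the sum over transversals factorises
  over the rows.
\<close>

lemma sum_walsh_transversal_mat:
  assumes "A \<subseteq> {..<n} \<times> {..<n}"
  shows "(\<Sum>k\<in>{..<n} \<rightarrow>\<^sub>E {..<n}. walsh A (transversal_mat n k))
       = (\<Prod>j<n. real n - 2 * real (row_count n A j))"
proof -
  have "(\<Sum>k\<in>{..<n} \<rightarrow>\<^sub>E {..<n}. walsh A (transversal_mat n k))
      = (\<Sum>k\<in>{..<n} \<rightarrow>\<^sub>E {..<n}. \<Prod>j<n. if (j, k j) \<in> A then - 1 else 1)"
  proof (rule sum.cong[OF refl])
    fix k assume "k \<in> {..<n} \<rightarrow>\<^sub>E {..<n}"
    then have k: "k j < n" if "j < n" for j
      using that by auto
    have "walsh A (transversal_mat n k) = (\<Prod>j<n. walsh A (mat_unit n j (k j)))"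
      unfolding transversal_mat_def by (rule walsh_finsum[OF _ _ assms]) simp_all
    also have "\<dots> = (\<Prod>j<n. if (j, k j) \<in> A then - 1 else 1)"
      using k by (intro prod.cong refl walsh_mat_unit[OF assms]) simp_all
    finally show "walsh A (transversal_mat n k) = (\<Prod>j<n. if (j, k j) \<in> A then - 1 else 1)" .
  qed
  also have "\<dots> = (\<Prod>j<n. \<Sum>k<n. if (j, k) \<in> A then - 1 else 1)"
    by (rule prod_sum_PiE[symmetric]) auto
  finally show ?thesis
    by (simp add: sum_sign_row)
qed

section \<open>Comparison of eigenvalues\<close>

definition sharp_const :: "nat \<Rightarrow> real" where
  "sharp_const n = 2 * real n / (real n ^ n - (real n - 2) ^ n)"

lemma sharp_const_denominator_pos:
  assumes "n \<in> even_pos"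
  shows "real n ^ n - (real n - 2) ^ n > 0"
proof -
  have "n \<ge> 2"
    using assms by (auto simp: even_pos_def elim!: evenE)
  then have "(real n - 2) ^ n < real n ^ n"
    by (intro power_strict_mono) auto
  then show ?thesis
    by simp
qed

text \<open>
  After division by $1 - q$ (for $q < 1$), this says that the mean of $1, q, \ldots, q^{n-1}$ is at most
  that of the first $m$ of these decreasing terms.
\<close>

lemma geometric_concave:
  fixes q :: real
  assumes "0 \<le> q" "q \<le> 1" "m \<le> n"
  shows "real m * (1 - q ^ n) \<le> real n * (1 - q ^ m)"
proof -
  obtain d where n: "n = m + d"
    using assms(3) by (metis le_add_diff_inverse)
  \<comment> \<open>The terms with index below m are at least $q^m$, the remaining d terms are at most $q^m$.\<close>
  have "real m * q ^ m = (\<Sum>i<m. q ^ m)"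
    by simp
  also have "\<dots> \<le> (\<Sum>i<m. q ^ i)"
    using assms by (intro sum_mono power_decreasing) auto
  finally have "(1 - q) * (real m * q ^ m) \<le> (1 - q) * (\<Sum>i<m. q ^ i)"
    using assms by (intro mult_left_mono) auto
  then have 1: "(1 - q) * (real m * q ^ m) \<le> 1 - q ^ m"
    by (simp add: one_diff_power_eq)
  have "(1 - q) * (\<Sum>i<d. q ^ i) \<le> (1 - q) * (\<Sum>i<d. 1)"
    using assms by (intro mult_left_mono sum_mono power_le_one) auto
  then have "1 - q ^ d \<le> (1 - q) * real d"
    by (simp add: one_diff_power_eq)
  then have "real m * q ^ m * (1 - q ^ d) \<le> real m * q ^ m * ((1 - q) * real d)"
    using assms by (intro mult_left_mono) auto
  also have "\<dots> \<le> real d * (1 - q ^ m)"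
    using mult_left_mono[OF 1, of "real d"] by (simp add: mult_ac)
  finally show ?thesis
    by (simp add: n power_add algebra_simps)
qed

text \<open>
  This is where the parity of $n$ enters: an odd count lies strictly between $0$ and $n$, which
  makes the factor at most $n - 2$ in modulus.
\<close>

lemma prod_row_deficits_le:
  assumes "even n"
  shows "(\<Prod>j<n. real n - 2 * real (row_count n A j))
    \<le> (real n - 2) ^ card {j\<in>{..<n}. odd (row_count n A j)}
        * real n ^ (n - card {j\<in>{..<n}. odd (row_count n A j)})"
proof -
  let ?O = "{j\<in>{..<n}. odd (row_count n A j)}"
  have factor: "\<bar>real n - 2 * real (row_count n A j)\<bar>
      \<le> (if odd (row_count n A j) then real n - 2 else real n)" if "j < n" for j
  proof -
    have le: "row_count n A j \<le> n"
      using card_mono[of "{..<n}" "{k\<in>{..<n}. (j, k) \<in> A}"] by (auto simp: row_count_def)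
    have "1 \<le> row_count n A j" "row_count n A j \<le> n - 1" "n \<ge> 1" if "odd (row_count n A j)"
    proof -
      show "1 \<le> row_count n A j"
        using that by (cases "row_count n A j") auto
      have "row_count n A j \<noteq> n"
        using that assms by auto
      with le \<open>j < n\<close> show "row_count n A j \<le> n - 1" "n \<ge> 1" by auto
    qed
    with le show ?thesis
      by (auto simp: of_nat_diff)
  qed
  have "(\<Prod>j<n. real n - 2 * real (row_count n A j))
      \<le> (\<Prod>j<n. \<bar>real n - 2 * real (row_count n A j)\<bar>)"
    unfolding abs_prod[symmetric] by simp
  also have "\<dots> \<le> (\<Prod>j<n. if odd (row_count n A j) then real n - 2 else real n)"
    using factor by (intro prod_mono) auto
  also have "\<dots> = (real n - 2) ^ card ?O * real n ^ card ({..<n} - ?O)"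
  proof -
    have "{..<n} \<inter> {j. odd (row_count n A j)} = ?O" "{..<n} \<inter> - {j. odd (row_count n A j)} = {..<n} - ?O"
      by auto
    then show ?thesis
      by (simp only: prod.If_cases[OF finite_lessThan] prod_constant)
  qed
  also have "card ({..<n} - ?O) = n - card ?O"
    by (subst card_Diff_subset) auto
  finally show ?thesis .
qed

text \<open>
  The comparison of the two eigenvalues attached to the character of $A$.
\<close>

lemma spectral_inequality:
  assumes n: "n \<in> even_pos" and A: "A \<subseteq> {..<n} \<times> {..<n}"
  shows "(\<Sum>j<n. (walsh A (row_mat n j) - 1)\<^sup>2)
    \<le> sharp_const n * (\<Sum>k\<in>{..<n} \<rightarrow>\<^sub>E {..<n}. (walsh A (transversal_mat n k) - 1)\<^sup>2)"
proof -
  define m where "m = card {j\<in>{..<n}. odd (row_count n A j)}"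
  define q where "q = (real n - 2) / real n"
  have "n \<ge> 2" "even n"
    using n by (auto simp: even_pos_def elim!: evenE)
  have "m \<le> n"
    using card_mono[of "{..<n}" "{j\<in>{..<n}. odd (row_count n A j)}"] by (auto simp: m_def)
  have q: "0 \<le> q" "q \<le> 1" "real n - 2 = q * real n"
    using \<open>n \<ge> 2\<close> by (auto simp: q_def)
  \<comment> \<open>A row with an odd count contributes $(-1-1)^2$, any other row nothing.\<close>
  have "(\<Sum>j<n. (walsh A (row_mat n j) - 1)\<^sup>2)
      = (\<Sum>j<n. if odd (row_count n A j) then 4 else 0)"
    by (intro sum.cong) (auto simp: walsh_row_mat[OF A])
  then have rows: "(\<Sum>j<n. (walsh A (row_mat n j) - 1)\<^sup>2) = 4 * real m"
    by (simp add: sum.If_cases m_def Int_def)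
  have "(\<Sum>k\<in>{..<n} \<rightarrow>\<^sub>E {..<n}. (walsh A (transversal_mat n k) - 1)\<^sup>2)
      = (\<Sum>k\<in>{..<n} \<rightarrow>\<^sub>E {..<n}. 2 - 2 * walsh A (transversal_mat n k))"
    by (intro sum.cong) (simp_all add: power2_diff)
  also have "\<dots> = 2 * real n ^ n - 2 * (\<Prod>j<n. real n - 2 * real (row_count n A j))"
    by (simp add: sum_subtractf sum_distrib_left[symmetric] sum_walsh_transversal_mat[OF A] card_PiE)
  also have "\<dots> \<ge> 2 * real n ^ n - 2 * ((real n - 2) ^ m * real n ^ (n - m))"
    using prod_row_deficits_le[OF \<open>even n\<close>, of A] by (simp add: m_def)
  also have "(real n - 2) ^ m * real n ^ (n - m) = q ^ m * real n ^ n"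
    using \<open>m \<le> n\<close> by (simp add: q(3) power_mult_distrib power_add[symmetric])
  finally have transversals: "2 * real n ^ n * (1 - q ^ m)
      \<le> (\<Sum>k\<in>{..<n} \<rightarrow>\<^sub>E {..<n}. (walsh A (transversal_mat n k) - 1)\<^sup>2)"
    by (simp add: algebra_simps)
  have denominator: "real n ^ n - (real n - 2) ^ n = real n ^ n * (1 - q ^ n)"
    by (simp add: q(3) power_mult_distrib algebra_simps)
  have "real m * (1 - q ^ n) \<le> real n * (1 - q ^ m)"
    using q \<open>m \<le> n\<close> by (intro geometric_concave) auto
  then have "4 * real n ^ n * (real m * (1 - q ^ n)) \<le> 4 * real n ^ n * (real n * (1 - q ^ m))"
    by (intro mult_left_mono) auto
  then have "4 * real m * (real n ^ n - (real n - 2) ^ n) \<le> 2 * real n * (2 * real n ^ n * (1 - q ^ m))"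
    unfolding denominator by (simp only: mult_ac)
  then have "4 * real m \<le> sharp_const n * (2 * real n ^ n * (1 - q ^ m))"
    using sharp_const_denominator_pos[OF n]
    by (simp only: sharp_const_def times_divide_eq_left pos_le_divide_eq)
  also have "\<dots> \<le> sharp_const n * (\<Sum>k\<in>{..<n} \<rightarrow>\<^sub>E {..<n}. (walsh A (transversal_mat n k) - 1)\<^sup>2)"
    using sharp_const_denominator_pos[OF n]
    by (intro mult_left_mono transversals) (auto simp: sharp_const_def)
  finally show ?thesis
    unfolding rows .
qed

section \<open>Functions with values in $\{0,1\}$\<close>

lemma row_variation_alt:
  "row_variation n f = (\<Sum>j<n. \<Sum>x\<in>carrier_mat n n. dist (f (x + row_mat n j)) (f x))"
  by (simp only: row_variation_def row_mat_def)

lemma transversal_variation_alt: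
  "transversal_variation n f =
     (\<Sum>k\<in>{..<n} \<rightarrow>\<^sub>E {..<n}. \<Sum>x\<in>carrier_mat n n. dist (f (x + transversal_mat n k)) (f x))"
  by (simp only: transversal_variation_def transversal_mat_def)

lemma transversal_variation_nonneg: "0 \<le> transversal_variation n f"
  unfolding transversal_variation_def by (intro sum_nonneg zero_le_dist)

text \<open>
  For values in $\{0,1\}$ distances coincide with squared distances, so Parseval turns both
  variations into sums over characters, which are compared term by term.
\<close>

lemma variation_inequality_zero_one:
  fixes g :: "bit mat \<Rightarrow> real"
  assumes n: "n \<in> even_pos" and g: "\<And>x. g x \<in> {0, 1}"
  shows "row_variation n g \<le> sharp_const n * transversal_variation n g"
proof -
  let ?P = "Pow ({..<n} \<times> {..<n})" and ?T = "{..<n} \<rightarrow>\<^sub>E {..<n}"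
  have dist_sq: "dist (g x) (g y) = (g x - g y)\<^sup>2" for x y
    using g[of x] g[of y] by (auto simp: dist_real_def)
  have "2 ^ (n * n) * row_variation n g
      = (\<Sum>j<n. \<Sum>A\<in>?P. (walsh A (row_mat n j) - 1)\<^sup>2 * (walsh_coeff n g A)\<^sup>2)"
    by (simp add: row_variation_alt dist_sq sum_distrib_left[of _ _ "{..<n}"] sum_increment_squared)
  also have "\<dots> = (\<Sum>A\<in>?P. \<Sum>j<n. (walsh A (row_mat n j) - 1)\<^sup>2 * (walsh_coeff n g A)\<^sup>2)"
    by (rule sum.swap)
  also have "\<dots> \<le> (\<Sum>A\<in>?P. sharp_const n *
      (\<Sum>k\<in>?T. (walsh A (transversal_mat n k) - 1)\<^sup>2) * (walsh_coeff n g A)\<^sup>2)"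
    unfolding sum_distrib_right[symmetric]
    by (intro sum_mono mult_right_mono spectral_inequality[OF n]) auto
  also have "\<dots> = sharp_const n *
      (\<Sum>A\<in>?P. \<Sum>k\<in>?T. (walsh A (transversal_mat n k) - 1)\<^sup>2 * (walsh_coeff n g A)\<^sup>2)"
    by (simp only: mult.assoc sum_distrib_left[symmetric] sum_distrib_right)
  also have "(\<Sum>A\<in>?P. \<Sum>k\<in>?T. (walsh A (transversal_mat n k) - 1)\<^sup>2 * (walsh_coeff n g A)\<^sup>2)
      = (\<Sum>k\<in>?T. \<Sum>A\<in>?P. (walsh A (transversal_mat n k) - 1)\<^sup>2 * (walsh_coeff n g A)\<^sup>2)"
    by (rule sum.swap)
  also have "\<dots> = 2 ^ (n * n) * transversal_variation n g"
    by (simp add: transversal_variation_alt dist_sq sum_distrib_left[of _ _ ?T] sum_increment_squared)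
  finally show ?thesis
    by (simp add: mult.left_commute[of "sharp_const n"])
qed


section \<open>Decomposition of $L_1$ into cuts\<close>

text \<open>
  Both variations are linear in the metric pulled back along $f$, so the inequality is inherited by
  every metric that is an integral of metrics for which it holds.  It is used twice: to pass from indicators to
  real functions, and from real functions to $L_1$.
\<close>

lemma variation_inequality_integral:
  fixes F :: "bit mat \<Rightarrow> 'a \<Rightarrow> real" and f :: "bit mat \<Rightarrow> 'b::metric_space"
  assumes ineq: "\<And>t. row_variation n (\<lambda>x. F x t) \<le> K * transversal_variation n (\<lambda>x. F x t)"
    and int: "\<And>x y. integrable M (\<lambda>t. dist (F x t) (F y t))"
    and dist: "\<And>x y. dist (f x) (f y) = (\<integral>t. dist (F x t) (F y t) \<partial>M)"
  shows "row_variation n f \<le> K * transversal_variation n f"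
proof -
  have "row_variation n f = (\<integral>t. row_variation n (\<lambda>x. F x t) \<partial>M)"
    unfolding row_variation_alt dist
    by (simp add: Bochner_Integration.integral_sum int)
  also have "\<dots> \<le> (\<integral>t. K * transversal_variation n (\<lambda>x. F x t) \<partial>M)"
    using ineq by (intro integral_mono)
      (auto simp: row_variation_alt transversal_variation_alt int)
  also have "\<dots> = K * transversal_variation n f"
    unfolding transversal_variation_alt dist
    by (simp add: Bochner_Integration.integral_sum int)
  finally show ?thesis .
qed

text \<open>
  The line is an integral of cut metrics: the level $t$ separates $a$ from $b$ exactly when it lies
  between them.
\<close>

lemma
  fixes a b :: real
  shows integrable_level_dist:
      "integrable lborel (\<lambda>t. dist (indicator {..<a} t :: real) (indicator {..<b} t))"
    and integral_level_dist:
      "(\<integral>t. dist (indicator {..<a} t :: real) (indicator {..<b} t) \<partial>lborel) = dist a b"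
proof -
  have eq: "(\<lambda>t. dist (indicator {..<a} t :: real) (indicator {..<b} t))
      = indicator {min a b..<max a b}"
    by (auto simp: fun_eq_iff indicator_def dist_real_def)
  show "integrable lborel (\<lambda>t. dist (indicator {..<a} t :: real) (indicator {..<b} t))"
    unfolding eq by (subst integrable_indicator_iff) auto
  show "(\<integral>t. dist (indicator {..<a} t :: real) (indicator {..<b} t) \<partial>lborel) = dist a b"
    unfolding eq by (auto simp: dist_real_def min_def max_def)
qed

lemma variation_inequality_real:
  fixes g :: "bit mat \<Rightarrow> real"
  assumes "n \<in> even_pos"
  shows "row_variation n g \<le> sharp_const n * transversal_variation n g"
proof (rule variation_inequality_integral[where F = "\<lambda>x. indicator {..<g x}" and M = lborel])
  show "row_variation n (\<lambda>x. indicator {..<g x} t :: real)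
      \<le> sharp_const n * transversal_variation n (\<lambda>x. indicator {..<g x} t :: real)" for t
    by (rule variation_inequality_zero_one[OF assms]) (simp split: split_indicator)
  show "integrable lborel (\<lambda>t. dist (indicator {..<g x} t :: real) (indicator {..<g y} t))" for x y
    by (rule integrable_level_dist)
  show "dist (g x) (g y) = (\<integral>t. dist (indicator {..<g x} t :: real) (indicator {..<g y} t) \<partial>lborel)" for x y
    by (rule integral_level_dist[symmetric])
qed

lemma L1_representative:
  fixes f :: "'a \<Rightarrow> L1"
  obtains F :: "'a \<Rightarrow> real \<Rightarrow> real"
  where "\<And>x. integrable (lebesgue_on {0<..<1}) (F x)"
    and "\<And>x y. dist (f x) (f y) = (\<integral>t. dist (F x t) (F y t) \<partial>lebesgue_on {0<..<1})"
proof
  define F where "F = (\<lambda>x. rep_L1 (f x))"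
  have rel: "L1_eq (F x) (F x)" "f x = abs_L1 (F x)" for x
    unfolding F_def using Quotient3_rep_reflp[OF Quotient3_L1] Quotient3_abs_rep[OF Quotient3_L1]
    by metis+
  show "integrable (lebesgue_on {0<..<1}) (F x)" for x
    using rel(1)[of x] by (simp add: L1_eq_def)
  show "dist (f x) (f y) = (\<integral>t. dist (F x t) (F y t) \<partial>lebesgue_on {0<..<1})" for x y
  proof -
    have "L1_eq (\<lambda>t. F x t - F y t) (\<lambda>t. F x t - F y t)"
      using rel(1)[of x] rel(1)[of y] by (simp add: L1_eq_def)
    then show ?thesis
      unfolding dist_norm rel(2)[of x] rel(2)[of y]
      by (simp add: minus_L1.abs_eq norm_L1.abs_eq rel(1))
  qed
qed

lemma variation_inequality_L1:
  fixes f :: "bit mat \<Rightarrow> L1"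
  assumes "n \<in> even_pos"
  shows "row_variation n f \<le> sharp_const n * transversal_variation n f"
proof -
  obtain F :: "bit mat \<Rightarrow> real \<Rightarrow> real"
    where int: "\<And>x. integrable (lebesgue_on {0<..<1}) (F x)"
      and dist: "\<And>x y. dist (f x) (f y) = (\<integral>t. dist (F x t) (F y t) \<partial>lebesgue_on {0<..<1})"
    by (rule L1_representative[of f]) blast
  show ?thesis
  proof (rule variation_inequality_integral[where F = F and M = "lebesgue_on {0<..<1}"])
    show "row_variation n (\<lambda>x. F x t) \<le> sharp_const n * transversal_variation n (\<lambda>x. F x t)" for t
      by (rule variation_inequality_real[OF assms])
    show "integrable (lebesgue_on {0<..<1}) (\<lambda>t. dist (F x t) (F y t))" for x y
      unfolding dist_real_def by (intro integrable_abs Bochner_Integration.integrable_diff int)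
  qed (rule dist)
qed


section \<open>An extremal function\<close>

text \<open>
  For the character of the first column each increment has constant norm, which makes both variations computable
  exactly; every row has count $1$, the extremal case of the spectral inequality.
\<close>

lemma variation_first_column_walsh:
  fixes u :: "'a::real_normed_vector"
  assumes "n > 0"
  defines "f \<equiv> \<lambda>x. walsh ({..<n} \<times> {0}) x *\<^sub>R u"
  defines "c \<equiv> real (card (carrier_mat n n :: bit mat set)) * norm u"
  shows "row_variation n f = 2 * real n * c"
    and "transversal_variation n f = (real n ^ n - (real n - 2) ^ n) * c"
proof -
  let ?A = "{..<n} \<times> {0 :: nat}"
  have A: "?A \<subseteq> {..<n} \<times> {..<n}"
    using assms(1) by auto
  have count: "row_count n ?A j = 1" if "j < n" for j
  proof -
    have "{k\<in>{..<n}. (j, k) \<in> ?A} = {0}"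
      using that assms(1) by auto
    then show ?thesis
      by (simp add: row_count_def)
  qed
  have increments: "(\<Sum>x\<in>carrier_mat n n. dist (f (x + a)) (f x)) = (1 - walsh ?A a) * c"
    if "a \<in> carrier_mat n n" for a
  proof -
    have "dist (f (x + a)) (f x) = (1 - walsh ?A a) * norm u" if "x \<in> carrier_mat n n" for x
    proof -
      have "f (x + a) - f x = (walsh ?A x * (walsh ?A a - 1)) *\<^sub>R u"
        using that \<open>a \<in> carrier_mat n n\<close> by (simp add: f_def walsh_add[OF A] algebra_simps)
      then show ?thesis
        using walsh_pm_one[of ?A a] by (auto simp: dist_norm abs_mult)
    qed
    then show ?thesis
      by (simp add: c_def)
  qed
  show "row_variation n f = 2 * real n * c"
    by (simp add: row_variation_alt increments walsh_row_mat[OF A] count)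
  show "transversal_variation n f = (real n ^ n - (real n - 2) ^ n) * c"
    by (simp add: transversal_variation_alt increments sum_distrib_right[symmetric] sum_subtractf
        sum_walsh_transversal_mat[OF A] count card_PiE)
qed

text \<open>
  The extremal function lives on the real line spanned by $u$, so the same constant is optimal for
  every nonzero normed space in which the inequality holds.
\<close>

lemma sharp_const_optimal:
  fixes u :: "'a::real_normed_vector"
  assumes n: "n \<in> even_pos" and "u \<noteq> 0" and K: "K < sharp_const n"
  shows "\<exists>f :: bit mat \<Rightarrow> 'a. \<not> row_variation n f \<le> K * transversal_variation n f"
proof -
  have "n > 0"
    using n by (simp add: even_pos_def)
  define c where "c = real (card (carrier_mat n n :: bit mat set)) * norm u"
  have "(0\<^sub>m n n :: bit mat) \<in> carrier_mat n n"
    by (rule zero_carrier_mat)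
  then have "carrier_mat n n \<noteq> ({} :: bit mat set)"
    by (metis empty_iff)
  then have "c > 0"
    using \<open>u \<noteq> 0\<close> finite_carrier_mat_bit by (auto simp: c_def card_gt_0_iff)
  moreover have "K * (real n ^ n - (real n - 2) ^ n) < 2 * real n"
    using K sharp_const_denominator_pos[OF n] by (simp add: sharp_const_def pos_less_divide_eq)
  ultimately have "K * (real n ^ n - (real n - 2) ^ n) * c < 2 * real n * c"
    by (intro mult_strict_right_mono)
  then show ?thesis
    unfolding not_le
    by (intro exI[of _ "\<lambda>x. walsh ({..<n} \<times> {0}) x *\<^sub>R u"])
      (simp only: variation_first_column_walsh[OF \<open>n > 0\<close>] c_def mult.assoc)
qed

lemma L1_nontrivial: "\<exists>u :: L1. u \<noteq> 0"
proof -
  have one: "L1_eq (\<lambda>_. 1) (\<lambda>_. 1)"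
    using finite_measure.integrable_const[OF finite_measure_lebesgue_on[of "{0<..<1::real}"]]
    by (simp add: L1_eq_def bounded_set_imp_lmeasurable)
  have "norm (abs_L1 (\<lambda>_. 1)) = 1"
    by (simp add: norm_L1.abs_eq[OF one] measure_restrict_space)
  then show ?thesis
    by (metis norm_zero zero_neq_one)
qed


section \<open>The optimal dimension-free constant\<close>

definition KS_const :: "nat \<Rightarrow> real" where
  "KS_const n = 2 / (1 - (1 - 2 / real n) ^ n)"

text \<open>
  This is $2 / (1 - e^{-2})$, the value obtained when $(1 - 2/n)^n$ is replaced by its limit.
\<close>

definition KS_limit :: real where
  "KS_limit = 2 * (exp 1)\<^sup>2 / ((exp 1)\<^sup>2 - 1)"

lemma KS_const_sharp_const:
  assumes "n \<in> even_pos"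
  shows "KS_const n / real n ^ n = sharp_const n / real n"
proof -
  have "n > 0"
    using assms by (simp add: even_pos_def)
  then have "(1 - 2 / real n) ^ n = (real n - 2) ^ n / real n ^ n"
    by (simp add: power_divide[symmetric] diff_divide_distrib)
  with \<open>n > 0\<close> sharp_const_denominator_pos[OF assms] show ?thesis
    by (simp add: KS_const_def sharp_const_def field_simps)
qed

lemma KS_inequality_iff:
  assumes "n \<in> even_pos"
  shows "KS_inequality C n f \<longleftrightarrow> row_variation n f \<le> real n * C / real n ^ n * transversal_variation n f"
  using assms by (simp add: KS_inequality_def even_pos_def field_simps)

lemma KS_limit_alt: "KS_limit = 2 / (1 - exp (- 2))"
proof -
  have "(exp 1)\<^sup>2 = (exp 2 :: real)"
    by (simp add: exp_double[symmetric])
  then show ?thesis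
    by (simp add: KS_limit_def exp_minus field_simps)
qed

lemma KS_const_le_limit:
  assumes "n \<in> even_pos"
  shows "KS_const n \<le> KS_limit"
proof -
  have n: "n \<ge> 2"
    using assms by (auto simp: even_pos_def elim!: evenE)
  have "(1 - 2 / real n) ^ n \<le> exp (- 2 / real n) ^ n"
    using n exp_ge_add_one_self[of "- 2 / real n"] by (intro power_mono) auto
  also have "\<dots> = exp (- 2)"
    using n by (simp add: exp_of_nat_mult[symmetric])
  finally have "(1 - 2 / real n) ^ n \<le> exp (- 2)" .
  moreover have "exp (- 2 :: real) < 1"
    by simp
  ultimately show ?thesis
    unfolding KS_const_def KS_limit_alt by (intro divide_left_mono mult_pos_pos) linarith+
qed

lemma KS_const_tendsto: "KS_const \<longlonglongrightarrow> KS_limit"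
proof -
  have "(\<lambda>n. 2 / (1 - (1 + (- 2) / real n) ^ n)) \<longlonglongrightarrow> 2 / (1 - exp (- 2))"
    by (intro tendsto_intros tendsto_exp_limit_sequentially) auto
  then show ?thesis
    by (simp add: KS_const_def[abs_def] KS_limit_alt)
qed

text \<open>
  The constants converge along all integers, hence also along the even ones.
\<close>

lemma less_KS_const:
  assumes "c < KS_limit"
  obtains n where "n \<in> even_pos" "c < KS_const n"
proof -
  have "eventually (\<lambda>n. c < KS_const n) sequentially"
    using KS_const_tendsto assms by (rule order_tendstoD)
  then obtain N where N: "\<And>n. n \<ge> N \<Longrightarrow> c < KS_const n"
    by (auto simp: eventually_sequentially)
  show ?thesis
    by (rule that[of "2 * (N + 1)"]) (auto simp: even_pos_def intro: N)
qed

lemma SUP_KS_const: "(SUP n\<in>even_pos. KS_const n) = KS_limit"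
proof (rule cSup_eq_non_empty)
  show "KS_const ` even_pos \<noteq> {}"
    by (auto simp: even_pos_def intro: exI[of _ 2])
  show "x \<le> KS_limit" if "x \<in> KS_const ` even_pos" for x
    using that KS_const_le_limit by auto
  show "KS_limit \<le> y" if "\<And>x. x \<in> KS_const ` even_pos \<Longrightarrow> x \<le> y" for y
    using that less_KS_const[of y] by (metis image_eqI leD leI)
qed

lemma KS_inequality_L1:
  fixes f :: "bit mat \<Rightarrow> L1"
  assumes n: "n \<in> even_pos"
  shows "KS_inequality KS_limit n f"
proof -
  have "n > 0"
    using n by (simp add: even_pos_def)
  have "sharp_const n = real n * KS_const n / real n ^ n"
    using KS_const_sharp_const[OF n] \<open>n > 0\<close> by (simp add: field_simps)
  also have "\<dots> \<le> real n * KS_limit / real n ^ n"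
    by (intro divide_right_mono mult_left_mono KS_const_le_limit[OF n]) auto
  finally have "sharp_const n * transversal_variation n f
      \<le> real n * KS_limit / real n ^ n * transversal_variation n f"
    by (rule mult_right_mono[OF _ transversal_variation_nonneg])
  with variation_inequality_L1[OF n, of f] show ?thesis
    unfolding KS_inequality_iff[OF n] by linarith
qed

lemma KS_limit_optimal:
  assumes "C < KS_limit"
  shows "\<exists>n\<in>even_pos. \<exists>f :: bit mat \<Rightarrow> L1. \<not> KS_inequality C n f"
proof -
  obtain n where n: "n \<in> even_pos" "C < KS_const n"
    using assms by (rule less_KS_const)
  have "n > 0"
    using n by (simp add: even_pos_def)
  have "real n * C / real n ^ n < real n * KS_const n / real n ^ n"
    using n \<open>n > 0\<close> by (intro divide_strict_right_mono mult_strict_left_mono) auto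
  also have "\<dots> = sharp_const n"
    using KS_const_sharp_const[OF n(1)] \<open>n > 0\<close> by (simp add: field_simps)
  finally have less: "real n * C / real n ^ n < sharp_const n" .
  obtain u :: L1 where "u \<noteq> 0"
    using L1_nontrivial by blast
  from sharp_const_optimal[OF n(1) this less] obtain f :: "bit mat \<Rightarrow> L1"
    where "\<not> row_variation n f \<le> real n * C / real n ^ n * transversal_variation n f" ..
  then have "\<not> KS_inequality C n f"
    unfolding KS_inequality_iff[OF n(1)] .
  with n(1) show ?thesis
    by blast
qed

theorem theorem1p7:
  shows
    "(\<forall>n\<in>even_pos.
        (\<forall>f :: bit mat \<Rightarrow> L1.
           row_variation n f
             \<le> 2 * real n / (real n ^ n - (real n - 2) ^ n) * transversal_variation n f) \<and>
        (\<forall>K < 2 * real n / (real n ^ n - (real n - 2) ^ n).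
           \<not> (\<forall>f :: bit mat \<Rightarrow> L1. row_variation n f \<le> K * transversal_variation n f))) \<and>
     KS_space TYPE(L1) \<and>
     bdd_above ((\<lambda>n. 2 / (1 - (1 - 2 / real n) ^ n)) ` even_pos) \<and>
     (\<exists>C. C = (SUP n\<in>even_pos. 2 / (1 - (1 - 2 / real n) ^ n)) \<and>
          C = 2 * (exp 1)\<^sup>2 / ((exp 1)\<^sup>2 - 1) \<and>
          (\<forall>n\<in>even_pos. \<forall>f :: bit mat \<Rightarrow> L1. KS_inequality C n f) \<and>
          (\<forall>C' < C. \<not> (\<forall>n\<in>even_pos. \<forall>f :: bit mat \<Rightarrow> L1. KS_inequality C' n f)))"
  unfolding sharp_const_def[symmetric] KS_const_def[symmetric] KS_limit_def[symmetric]
proof (intro conjI ballI exI[of _ KS_limit] allI impI)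
  show "row_variation n f \<le> sharp_const n * transversal_variation n f"
    if "n \<in> even_pos" for n and f :: "bit mat \<Rightarrow> L1"
    using that by (rule variation_inequality_L1)
  show "\<not> (\<forall>f :: bit mat \<Rightarrow> L1. row_variation n f \<le> K * transversal_variation n f)"
    if "n \<in> even_pos" "K < sharp_const n" for n K
    using that sharp_const_optimal L1_nontrivial by blast
  have "KS_limit > 0"
    by (simp add: KS_limit_alt)
  then show "KS_space TYPE(L1)"
    unfolding KS_space_def using KS_inequality_L1 by blast
  show "bdd_above (KS_const ` even_pos)"
    by (rule bdd_aboveI2[OF KS_const_le_limit])
  show "KS_limit = (SUP n\<in>even_pos. KS_const n)"
    by (rule SUP_KS_const[symmetric])
  show "KS_limit = KS_limit" ..
  show "KS_inequality KS_limit n f" if "n \<in> even_pos" for n and f :: "bit mat \<Rightarrow> L1"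
    using that by (rule KS_inequality_L1)
  show "\<not> (\<forall>n\<in>even_pos. \<forall>f :: bit mat \<Rightarrow> L1. KS_inequality C' n f)" if "C' < KS_limit" for C'
    using KS_limit_optimal[OF that] by blast
qed

end
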